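(* For every even positive integer $n$, let $G=G_n$ be the $4$-graph on $2n$ vertices whose vertex set is the union of two disjoint sets $A$ and $B$, each of cardinality $n$, and whose edges are all $4$-element subsets of $A\cup B$ that intersect $A$ in exactly two vertices. Then $G$ is $2$-chromatic, and for every real $p\geq 2$, $$\frac{\lambda^{(p)}(G)}{|\lambda_{\min}^{(p)}(G)|}=\Omega(n)\qquad (n\to\infty,\ n\text{ even}).$$ Consequently, the ratio $\lambda^{(p)}(G)/|\lambda_{\min}^{(p)}(G)|$ cannot be bounded from above by a function of the chromatic number of $G$ and $p$.
   Context: A $4$-graph $G$ is a $4$-uniform hypergraph with finite vertex set $V(G)$, identified with $[m]=\{1,\ldots,m\}$, and edge set $E(G)$ of $4$-element subsets of $V(G)$. Define $P_G:\mathbb{R}^m\to\mathbb{R}$ by $P_G(\mathbf{x}):=4!\sum_{\{i_1,i_2,i_3,i_4\}\in E(G)}x_{i_1}x_{i_2}x_{i_3}x_{i_4}$. For real $p\geq1$, let $|\mathbf{x}|_p=(\sum_i|x_i|^p)^{1/p}$ and define $$\lambda^{(p)}(G):=\max_{|\mathbf{x}|_p=1}P_G(\mathbf{x}),\qquad \lambda_{\min}^{(p)}(G):=\min_{|\mathbf{x}|_p=1}P_G(\mathbf{x}),$$ over real vectors $\mathbf{x}$. If $E(G)\neq\varnothing$ then $\lambda^{(p)}(G)>0$ and $\lambda_{\min}^{(p)}(G)<0$. A hypergraph $G$ is $k$-chromatic if $V(G)$ can be partitioned into $k$ sets so that no partition set contains an edge; the chromatic number is the least such $k$. $f(n)=\Omega(g(n))$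 for positive functions $f,g$ means that there is a constant $c>0$ (which may depend on the fixed $p$) such that $f(n)\geq c\,g(n)$ for all sufficiently large (even) $n$. *)

theory Defs
  imports Complex_Main "HOL-Library.FuncSet" "HOL-Library.Disjoint_Sets"
begin

record 'a hypergraph =
  verts :: "'a set"
  edges :: "'a set set"

definition four_graph :: "'a hypergraph \<Rightarrow> bool" where
  "four_graph G \<longleftrightarrow> finite (verts G) \<and> (\<forall>e\<in>edges G. e \<subseteq> verts G \<and> card e = 4)"

definition polyform :: "'a hypergraph \<Rightarrow> ('a \<Rightarrow> real) \<Rightarrow> real" where
  "polyform G x = fact 4 * (\<Sum>e\<in>edges G. \<Prod>i\<in>e. x i)"

definition pnorm :: "real \<Rightarrow> 'a set \<Rightarrow> ('a \<Rightarrow> real) \<Rightarrow> real" where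
  "pnorm p V x = (\<Sum>i\<in>V. \<bar>x i\<bar> powr p) powr (1 / p)"

text \<open>
  Real vectors indexed by \<open>V\<close> are the extensional functions in \<open>V \<rightarrow>\<^sub>E UNIV\<close>.
\<close>

definition psphere :: "real \<Rightarrow> 'a set \<Rightarrow> ('a \<Rightarrow> real) set" where
  "psphere p V = {x \<in> V \<rightarrow>\<^sub>E UNIV. pnorm p V x = 1}"

text \<open>
  The operators \<open>GREATEST\<close> and \<open>LEAST\<close> denote an attained maximum or minimum; their values are
  meaningful only when it exists, which for \<open>p \<ge> 1\<close> and a nonempty finite vertex set is ensured
  by compactness of the sphere.
\<close>

definition lambda_max :: "real \<Rightarrow> 'a hypergraph \<Rightarrow> real" where
  "lambda_max p G = (GREATEST y. y \<in> polyform G ` psphere p (verts G))"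

definition lambda_min :: "real \<Rightarrow> 'a hypergraph \<Rightarrow> real" where
  "lambda_min p G = (LEAST y. y \<in> polyform G ` psphere p (verts G))"

text \<open>
  Partition classes are nonempty, as in \<^const>\<open>partition_on\<close>; admitting empty classes would not
  change the least number of classes.
\<close>

definition k_chromatic :: "nat \<Rightarrow> 'a hypergraph \<Rightarrow> bool" where
  "k_chromatic k G \<longleftrightarrow>
     (\<exists>P. partition_on (verts G) P \<and> card P = k \<and> (\<forall>S\<in>P. \<forall>e\<in>edges G. \<not> e \<subseteq> S))"

definition chromatic_number :: "'a hypergraph \<Rightarrow> nat" where
  "chromatic_number G = (LEAST k. k_chromatic k G)"

definition two_two_graph :: "'a set \<Rightarrow> 'a set \<Rightarrow> 'a hypergraph" where
  "two_two_graph A B =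
     \<lparr>verts = A \<union> B, edges = {e. e \<subseteq> A \<union> B \<and> card e = 4 \<and> card (e \<inter> A) = 2}\<rparr>"

definition disjoint_pair :: "nat \<Rightarrow> 'a set \<Rightarrow> 'a set \<Rightarrow> bool" where
  "disjoint_pair n A B \<longleftrightarrow>
     finite A \<and> finite B \<and> A \<inter> B = {} \<and> card A = n \<and> card B = n"

end

theory Submission
  imports Defs "HOL-Analysis.Convex"
begin

text \<open>
  An edge of the graph is a pair in \<open>A\<close> together with a pair in \<open>B\<close>, so the polynomial form factors
  as \<open>P(x) = 6 (S\<^sup>2 - Q) (T\<^sup>2 - R)\<close>, where \<open>S, Q\<close> are the sum and the sum of squares of \<open>x\<close> over
  \<open>A\<close>, and \<open>T, R\<close> those over \<open>B\<close> (\<open>polyform_two_two_graph\<close>). By Cauchy--Schwarz the factors lie in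
  \<open>[-Q, (n-1) Q]\<close> and \<open>[-R, (n-1) R]\<close>. A negative value of the product needs one negative factor,
  which contributes no factor \<open>n-1\<close>; hence
  \<open>-6 (n-1) Q R \<le> P(x) \<le> 6 (n-1)\<^sup>2 Q R\<close>.

  On the \<open>p\<close>-sphere with \<open>p \<ge> 2\<close>, the power mean inequality bounds \<open>Q + R\<close>, and therefore \<open>Q R\<close>, by
  its value at a vector all of whose entries have the same modulus \<open>t\<close>, where \<open>t\<^sup>p = 1 / (2n)\<close>
  (\<open>sum_squares_psphere_le\<close>). Both resulting bounds are attained by such vectors: the constant vector
  gives the maximum, and the vector that is constant on \<open>A\<close> and takes the values \<open>t\<close> and \<open>-t\<close> equally
  often on \<open>B\<close>, which is where \<open>n\<close> must be even, gives \<open>T = 0\<close> and the minimum. So both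
  extrema are known exactly and their ratio is exactly \<open>n - 1\<close> (\<open>lambda_ratio_two_two_graph\<close>), which
  is unbounded although every graph of the family has chromatic number 2.
\<close>

section \<open>Factorization of the polynomial form\<close>

lemma sum_pair_products:
  fixes x :: "'a \<Rightarrow> real"
  assumes "finite A"
  shows "2 * (\<Sum>e | e \<subseteq> A \<and> card e = 2. \<Prod>i\<in>e. x i) = (\<Sum>i\<in>A. x i)\<^sup>2 - (\<Sum>i\<in>A. (x i)\<^sup>2)"
  using assms
proof induction
  case empty
  have no: "{e. e \<subseteq> ({}::'a set) \<and> card e = 2} = {}" by auto
  show ?case unfolding no by simp
next
  case (insert a F)
  let ?E = "\<lambda>A. {e. e \<subseteq> A \<and> card e = 2}"
  have split: "?E (insert a F) = ?E F \<union> (\<lambda>b. {a, b}) ` F"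
  proof (intro equalityI subsetI)
    fix e assume e: "e \<in> ?E (insert a F)"
    show "e \<in> ?E F \<union> (\<lambda>b. {a, b}) ` F"
    proof (cases "a \<in> e")
      case True
      then obtain b where "e = {a, b}" "b \<noteq> a"
        using e by (auto simp: card_2_iff)
      then show ?thesis using e by auto
    qed (use e in auto)
  next
    fix e assume "e \<in> ?E F \<union> (\<lambda>b. {a, b}) ` F"
    then consider "e \<in> ?E F" | b where "b \<in> F" "e = {a, b}" by auto
    then show "e \<in> ?E (insert a F)"
    proof cases
      case 2
      then have "a \<noteq> b" using insert.hyps by auto
      then show ?thesis using 2 by simp
    qed auto
  qed
  have disj: "?E F \<inter> (\<lambda>b. {a, b}) ` F = {}"
    using insert.hyps by auto
  have inj: "inj_on (\<lambda>b. {a, b}) F"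
    by (auto simp: inj_on_def doubleton_eq_iff)
  have fin: "finite (?E F)"
    using insert.hyps by simp
  have "(\<Sum>e\<in>?E (insert a F). \<Prod>i\<in>e. x i)
      = (\<Sum>e\<in>?E F. \<Prod>i\<in>e. x i) + (\<Sum>b\<in>F. \<Prod>i\<in>{a, b}. x i)"
    unfolding split
    using insert.hyps fin disj by (simp add: sum.union_disjoint sum.reindex[OF inj])
  also have "(\<Sum>b\<in>F. \<Prod>i\<in>{a, b}. x i) = (\<Sum>b\<in>F. x a * x b)"
    by (rule sum.cong[OF refl], subst prod.insert) (use insert.hyps in auto)
  also have "\<dots> = x a * (\<Sum>b\<in>F. x b)"
    by (simp add: sum_distrib_left)
  finally show ?case
    using insert by (simp add: power2_sum algebra_simps)
qed

lemma polyform_two_two_graph: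
  assumes "finite A" "finite B" "A \<inter> B = {}"
  shows "polyform (two_two_graph A B) x =
    6 * (((\<Sum>i\<in>A. x i)\<^sup>2 - (\<Sum>i\<in>A. (x i)\<^sup>2)) * ((\<Sum>i\<in>B. x i)\<^sup>2 - (\<Sum>i\<in>B. (x i)\<^sup>2)))"
proof -
  let ?E = "\<lambda>A. {e. e \<subseteq> A \<and> card e = 2}"
  let ?pr = "\<lambda>e. \<Prod>i\<in>e. x i"
  have "(\<Sum>e\<in>edges (two_two_graph A B). ?pr e) = (\<Sum>(d, e)\<in>?E A \<times> ?E B. ?pr d * ?pr e)"
  proof (rule sum.reindex_bij_witness[where i = "\<lambda>(d, e). d \<union> e" and j = "\<lambda>e. (e \<inter> A, e \<inter> B)"])
    fix e assume "e \<in> edges (two_two_graph A B)"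
    then have e: "e \<subseteq> A \<union> B" "card e = 4" "card (e \<inter> A) = 2"
      by (auto simp: two_two_graph_def)
    have eq: "e = (e \<inter> A) \<union> (e \<inter> B)" using e by blast
    have "card e = card (e \<inter> A) + card (e \<inter> B)"
      by (subst eq, rule card_Un_disjoint) (use assms in auto)
    then show "(e \<inter> A, e \<inter> B) \<in> ?E A \<times> ?E B" using e by auto
    show "(case (e \<inter> A, e \<inter> B) of (d, e) \<Rightarrow> d \<union> e) = e" using eq by simp
    have "?pr e = ?pr (e \<inter> A) * ?pr (e \<inter> B)"
      by (subst eq, rule prod.union_disjoint) (use assms in auto)
    then show "(case (e \<inter> A, e \<inter> B) of (d, e) \<Rightarrow> ?pr d * ?pr e) = ?pr e" by simp
  next
    fix q assume "q \<in> ?E A \<times> ?E B"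
    then obtain d e where q: "q = (d, e)" "d \<subseteq> A" "card d = 2" "e \<subseteq> B" "card e = 2" by auto
    have "(d \<union> e) \<inter> A = d" "(d \<union> e) \<inter> B = e" "d \<inter> e = {}" using q assms by auto
    moreover have "card (d \<union> e) = card d + card e"
      by (rule card_Un_disjoint) (use q assms finite_subset in auto)
    ultimately show "(case q of (d, e) \<Rightarrow> d \<union> e) \<in> edges (two_two_graph A B)"
      and "((case q of (d, e) \<Rightarrow> d \<union> e) \<inter> A, (case q of (d, e) \<Rightarrow> d \<union> e) \<inter> B) = q"
      using q by (auto simp: two_two_graph_def)
  qed
  also have "\<dots> = (\<Sum>d\<in>?E A. ?pr d) * (\<Sum>e\<in>?E B. ?pr e)"
    by (simp add: sum_product sum.cartesian_product)
  finally have "polyform (two_two_graph A B) x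
      = 6 * ((2 * (\<Sum>d\<in>?E A. ?pr d)) * (2 * (\<Sum>e\<in>?E B. ?pr e)))"
    by (simp add: polyform_def fact_numeral)
  then show ?thesis
    by (simp only: sum_pair_products assms)
qed

section \<open>Bounds on the sphere\<close>

lemma powr_inverse_exponent:
  fixes N p :: real
  assumes "N > 0" "p > 0"
  shows "(N powr (- 1 / p)) powr p = 1 / N"
proof -
  have "(N powr (- 1 / p)) powr p = N powr (- 1)"
    using assms by (simp only: powr_powr) simp
  then show ?thesis using assms by (simp only: powr_minus_divide) simp
qed

text \<open>
  The power mean inequality, obtained by summing the tangent-line bound
  \<open>(x/t)\<^sup>2 \<le> (2/p) (x/t)\<^sup>p + (1 - 2/p)\<close>, an instance of Young's inequality. It is an equality at
  \<open>x = t\<close>, so \<open>t\<close> is chosen as the common modulus of the entries of the expected extremal vectors.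
\<close>
lemma sum_squares_psphere_le:
  fixes p :: real
  assumes "finite V" "V \<noteq> {}" "p \<ge> 2" "x \<in> psphere p V"
  shows "(\<Sum>i\<in>V. (x i)\<^sup>2) \<le> real (card V) * (real (card V) powr (- 1 / p))\<^sup>2"
proof -
  let ?N = "real (card V)"
  let ?t = "?N powr (- 1 / p)"
  have N: "?N > 0" using assms by (simp add: card_gt_0_iff)
  then have t: "?t > 0" by simp
  have tp: "?t powr p = 1 / ?N"
    using powr_inverse_exponent[OF N, of p] assms by simp
  have "(\<Sum>i\<in>V. \<bar>x i\<bar> powr p) powr (1 / p) = 1"
    using assms by (simp add: psphere_def pnorm_def)
  then have "((\<Sum>i\<in>V. \<bar>x i\<bar> powr p) powr (1 / p)) powr p = 1" by simp
  then have sum1: "(\<Sum>i\<in>V. \<bar>x i\<bar> powr p) = 1"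
    using assms by (simp add: powr_powr sum_nonneg)
  have tangent: "(x i)\<^sup>2 / ?t\<^sup>2 \<le> 2 / p * (?N * \<bar>x i\<bar> powr p) + (1 - 2 / p)" for i
  proof (cases "x i = 0")
    case True
    then show ?thesis using assms by (simp add: field_simps)
  next
    case False
    let ?u = "\<bar>x i\<bar> / ?t"
    have u: "?u > 0" using False t by simp
    have "(?u powr p) powr (2 / p) * 1 powr (1 - 2 / p) \<le> 2 / p * (?u powr p) + (1 - 2 / p) * 1"
      by (rule Youngs_inequality_0) (use u assms in auto)
    moreover have "(?u powr p) powr (2 / p) = ?u\<^sup>2"
      using u assms by (simp add: powr_powr)
    moreover have "?u powr p = ?N * \<bar>x i\<bar> powr p"
      using t tp by (subst powr_divide) (auto simp: field_simps)
    ultimately show ?thesis by (simp add: power_divide)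
  qed
  have "(\<Sum>i\<in>V. (x i)\<^sup>2) / ?t\<^sup>2 \<le> (\<Sum>i\<in>V. 2 / p * (?N * \<bar>x i\<bar> powr p) + (1 - 2 / p))"
    unfolding sum_divide_distrib by (rule sum_mono) (rule tangent)
  also have "\<dots> = 2 / p * (?N * (\<Sum>i\<in>V. \<bar>x i\<bar> powr p)) + ?N * (1 - 2 / p)"
    by (simp add: sum.distrib sum_distrib_left)
  also have "\<dots> = ?N"
    unfolding sum1 by (simp add: algebra_simps)
  finally show ?thesis
    using t by (simp add: pos_divide_le_eq)
qed

lemma equimodular_in_psphere:
  fixes p :: real
  assumes "finite V" "V \<noteq> {}" "p \<ge> 2"
    and "\<And>i. i \<in> V \<Longrightarrow> \<bar>s i\<bar> = 1"
  shows "restrict (\<lambda>i. real (card V) powr (- 1 / p) * s i) V \<in> psphere p V"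
proof -
  have N: "real (card V) > 0" using assms by (simp add: card_gt_0_iff)
  have "(\<Sum>i\<in>V. \<bar>restrict (\<lambda>i. real (card V) powr (- 1 / p) * s i) V i\<bar> powr p)
      = (\<Sum>i\<in>V. 1 / real (card V))"
    using powr_inverse_exponent[OF N, of p] assms
    by (intro sum.cong) (auto simp: abs_mult)
  also have "\<dots> = 1" using N by simp
  finally show ?thesis by (simp add: psphere_def pnorm_def)
qed

text \<open>
  The asymmetry between the two bounds is the source of the ratio: a product of reals in \<open>[-Q, m Q]\<close>
  and \<open>[-R, m R]\<close> can pick up the factor \<open>m\<close> twice when positive, but only once when negative.
\<close>
lemma asymmetric_product_bounds:
  fixes a b m Q R :: real
  assumes "- Q \<le> a" "a \<le> m * Q" "- R \<le> b" "b \<le> m * R" "0 \<le> Q" "0 \<le> R" "1 \<le> m"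
  shows "- (m * (Q * R)) \<le> a * b" "a * b \<le> m\<^sup>2 * (Q * R)"
proof -
  have neg: "- (m * (Q * R)) \<le> c * d"
    if "0 \<le> c" "c \<le> m * Q'" "- R' \<le> d" "d \<le> 0" "Q' * R' = Q * R" "0 \<le> R'" for c d Q' R' :: real
  proof -
    have "c * (- d) \<le> (m * Q') * R'"
      by (rule mult_mono) (use that in auto)
    then show ?thesis using that(5) by (simp add: mult.assoc)
  qed
  have QR: "0 \<le> m * (Q * R)" using assms by simp
  consider "0 \<le> a" "0 \<le> b" | "a \<le> 0" "b \<le> 0" | "0 \<le> a" "b \<le> 0" | "a \<le> 0" "0 \<le> b" by linarith
  then show "- (m * (Q * R)) \<le> a * b"
  proof cases
    case 1
    then have "0 \<le> a * b" by simp
    then show ?thesis using QR by linarith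
  next
    case 2
    then have "0 \<le> a * b" by (rule mult_nonpos_nonpos)
    then show ?thesis using QR by linarith
  next
    case 3
    then show ?thesis using neg[of a Q R b] assms by simp
  next
    case 4
    then show ?thesis using neg[of b R Q a] assms by (simp add: mult.commute)
  qed
  have "Q \<le> m * Q" "R \<le> m * R"
    using assms mult_right_mono[of 1 m Q] mult_right_mono[of 1 m R] by auto
  then have "\<bar>a\<bar> \<le> m * Q" "\<bar>b\<bar> \<le> m * R" using assms by auto
  then have "\<bar>a\<bar> * \<bar>b\<bar> \<le> (m * Q) * (m * R)"
    by (intro mult_mono) (use assms in auto)
  moreover have "a * b \<le> \<bar>a\<bar> * \<bar>b\<bar>" by (metis abs_ge_self abs_mult)
  ultimately show "a * b \<le> m\<^sup>2 * (Q * R)" by (simp add: power2_eq_square algebra_simps)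
qed

lemma polyform_bounds:
  fixes p :: real and A B :: "'a set"
  assumes AB: "disjoint_pair n A B" and "n \<ge> 2" "p \<ge> 2"
    and x: "x \<in> psphere p (A \<union> B)"
  defines "M \<equiv> (real n * (real (2 * n) powr (- 1 / p))\<^sup>2)\<^sup>2"
  shows "- (6 * (real n - 1) * M) \<le> polyform (two_two_graph A B) x"
    and "polyform (two_two_graph A B) x \<le> 6 * (real n - 1)\<^sup>2 * M"
proof -
  have fin: "finite A" "finite B" "A \<inter> B = {}" and card: "card A = n" "card B = n"
    using AB by (auto simp: disjoint_pair_def)
  let ?Q = "\<Sum>i\<in>A. (x i)\<^sup>2" and ?R = "\<Sum>i\<in>B. (x i)\<^sup>2"
  let ?a = "(\<Sum>i\<in>A. x i)\<^sup>2 - ?Q" and ?b = "(\<Sum>i\<in>B. x i)\<^sup>2 - ?R"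
  have Q: "0 \<le> ?Q" and R: "0 \<le> ?R" by (auto intro: sum_nonneg)
  have a: "- ?Q \<le> ?a" "?a \<le> (real n - 1) * ?Q"
    using sum_squared_le_sum_of_squares[of x A] card by (auto simp: algebra_simps)
  have b: "- ?R \<le> ?b" "?b \<le> (real n - 1) * ?R"
    using sum_squared_le_sum_of_squares[of x B] card by (auto simp: algebra_simps)
  have "A \<union> B \<noteq> {}" using card assms by auto
  moreover have cV: "card (A \<union> B) = 2 * n" using fin card by (simp add: card_Un_disjoint)
  ultimately have "(\<Sum>i\<in>A \<union> B. (x i)\<^sup>2) \<le> real (2 * n) * (real (2 * n) powr (- 1 / p))\<^sup>2"
    using sum_squares_psphere_le[of "A \<union> B" p x] fin assms by simp
  then have "(?Q + ?R) / 2 \<le> real n * (real (2 * n) powr (- 1 / p))\<^sup>2"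
    using fin by (simp add: sum.union_disjoint)
  then have "((?Q + ?R) / 2)\<^sup>2 \<le> M"
    unfolding M_def by (rule power_mono) (use Q R in auto)
  moreover have "?Q * ?R \<le> ((?Q + ?R) / 2)\<^sup>2"
    using zero_le_power2[of "?Q - ?R"] by (simp add: power2_eq_square field_simps)
  ultimately have QR: "?Q * ?R \<le> M" by linarith
  have m: "1 \<le> real n - 1" using assms by simp
  note bounds = asymmetric_product_bounds[OF a b Q R m]
  have "(real n - 1) * (?Q * ?R) \<le> (real n - 1) * M"
    using QR m by (intro mult_left_mono) auto
  moreover have "(real n - 1)\<^sup>2 * (?Q * ?R) \<le> (real n - 1)\<^sup>2 * M"
    using QR by (intro mult_left_mono) auto
  ultimately have "- ((real n - 1) * M) \<le> ?a * ?b" "?a * ?b \<le> (real n - 1)\<^sup>2 * M"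
    using bounds by linarith+
  then show "- (6 * (real n - 1) * M) \<le> polyform (two_two_graph A B) x"
    and "polyform (two_two_graph A B) x \<le> 6 * (real n - 1)\<^sup>2 * M"
    unfolding polyform_two_two_graph[OF fin] by linarith+
qed

section \<open>The exact extrema\<close>

lemma polyform_equimodular:
  fixes t :: real and A B :: "'a set"
  assumes AB: "disjoint_pair n A B"
    and s: "\<And>i. i \<in> A \<union> B \<Longrightarrow> \<bar>s i\<bar> = 1"
  shows "polyform (two_two_graph A B) (restrict (\<lambda>i. t * s i) (A \<union> B)) =
    6 * ((t\<^sup>2 * ((\<Sum>i\<in>A. s i)\<^sup>2 - real n)) * (t\<^sup>2 * ((\<Sum>i\<in>B. s i)\<^sup>2 - real n)))"
proof -
  have fin: "finite A" "finite B" "A \<inter> B = {}" and card: "card A = n" "card B = n"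
    using AB by (auto simp: disjoint_pair_def)
  let ?x = "restrict (\<lambda>i. t * s i) (A \<union> B)"
  have part: "(\<Sum>i\<in>C. ?x i)\<^sup>2 - (\<Sum>i\<in>C. (?x i)\<^sup>2) = t\<^sup>2 * ((\<Sum>i\<in>C. s i)\<^sup>2 - real n)"
    if C: "C \<subseteq> A \<union> B" "card C = n" for C
  proof -
    have "(\<Sum>i\<in>C. ?x i) = t * (\<Sum>i\<in>C. s i)"
      unfolding sum_distrib_left by (rule sum.cong) (use C in auto)
    moreover have "(?x i)\<^sup>2 = t\<^sup>2" if "i \<in> C" for i
    proof -
      have "(s i)\<^sup>2 = 1" using s[of i] C that by (metis one_power2 power2_abs subsetD)
      then show ?thesis using C that by (auto simp: power_mult_distrib)
    qed
    then have "(\<Sum>i\<in>C. (?x i)\<^sup>2) = real n * t\<^sup>2" using C by simp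
    ultimately show ?thesis by (simp add: power_mult_distrib algebra_simps)
  qed
  show ?thesis
    unfolding polyform_two_two_graph[OF fin] using part[of A] part[of B] card by simp
qed

text \<open>
  Exhibiting points where the two bounds are attained also settles that the maximum and the minimum
  exist, so no compactness argument for the sphere is required.
\<close>
lemma lambda_two_two_graph:
  fixes p :: real and A B :: "'a set"
  assumes AB: "disjoint_pair n A B" and n: "n \<ge> 2" "even n" and p: "p \<ge> 2"
  defines "M \<equiv> (real n * (real (2 * n) powr (- 1 / p))\<^sup>2)\<^sup>2"
  shows "lambda_max p (two_two_graph A B) = 6 * (real n - 1)\<^sup>2 * M"
    and "lambda_min p (two_two_graph A B) = - (6 * (real n - 1) * M)"
proof -
  have fin: "finite A" "finite B" "A \<inter> B = {}" and card: "card A = n" "card B = n"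
    using AB by (auto simp: disjoint_pair_def)
  have cV: "card (A \<union> B) = 2 * n" using fin card by (simp add: card_Un_disjoint)
  have ne: "A \<union> B \<noteq> {}" using card n by auto
  let ?t = "real (2 * n) powr (- 1 / p)"
  let ?G = "two_two_graph A B"
  let ?x = "\<lambda>s. restrict (\<lambda>i. ?t * s i) (A \<union> B)"
  have V: "verts ?G = A \<union> B" by (simp add: two_two_graph_def)
  have sphere: "?x s \<in> psphere p (A \<union> B)" if "\<And>i. i \<in> A \<union> B \<Longrightarrow> \<bar>s i\<bar> = 1" for s
    using equimodular_in_psphere[of "A \<union> B" p s] that fin ne p cV by simp

  have "polyform ?G (?x (\<lambda>_. 1)) = 6 * (real n - 1)\<^sup>2 * M"
    by (subst polyform_equimodular[OF AB])
       (auto simp: card M_def power2_eq_square algebra_simps)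
  then have attained: "6 * (real n - 1)\<^sup>2 * M \<in> polyform ?G ` psphere p (verts ?G)"
    unfolding V by (rule image_eqI[OF sym sphere]) simp
  show "lambda_max p ?G = 6 * (real n - 1)\<^sup>2 * M"
    unfolding lambda_max_def
    by (rule Greatest_equality, rule attained)
       (use polyform_bounds(2)[OF AB n(1) p] in \<open>auto simp: V M_def\<close>)

  \<comment> \<open>Signs that cancel on \<open>B\<close> and agree on \<open>A\<close> make both asymmetric bounds tight at once.\<close>
  obtain C where C: "C \<subseteq> B" "card C = n div 2"
    using obtain_subset_with_card_n[of "n div 2" B] card by auto
  define s :: "'a \<Rightarrow> real" where "s i = (if i \<in> B - C then - 1 else 1)" for i
  have abs_s: "\<bar>s i\<bar> = 1" for i by (simp add: s_def)
  have sA: "(\<Sum>i\<in>A. s i) = real n"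
  proof -
    have "(\<Sum>i\<in>A. s i) = (\<Sum>i\<in>A. 1)"
      by (rule sum.cong) (use fin in \<open>auto simp: s_def\<close>)
    then show ?thesis using card by simp
  qed
  have sB: "(\<Sum>i\<in>B. s i) = 0"
  proof -
    have finC: "finite C" using C fin finite_subset by blast
    have "(\<Sum>i\<in>B. s i) = (\<Sum>i\<in>B - C. s i) + (\<Sum>i\<in>C. s i)"
      by (rule sum.subset_diff) (use C fin in auto)
    also have "(\<Sum>i\<in>B - C. s i) = - real (card (B - C))" by (simp add: s_def)
    also have "(\<Sum>i\<in>C. s i) = real (card C)"
      by (simp add: s_def)
    also have "card (B - C) = card C"
      using card_Diff_subset[OF finC C(1)] C card n by (auto elim: evenE)
    finally show ?thesis by simp
  qed
  have "polyform ?G (?x s) = - (6 * (real n - 1) * M)"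
    by (subst polyform_equimodular[OF AB abs_s])
       (simp add: sA sB M_def power2_eq_square algebra_simps)
  then have attained: "- (6 * (real n - 1) * M) \<in> polyform ?G ` psphere p (verts ?G)"
    unfolding V by (rule image_eqI[OF sym sphere]) (rule abs_s)
  show "lambda_min p ?G = - (6 * (real n - 1) * M)"
    unfolding lambda_min_def
    by (rule Least_equality, rule attained)
       (use polyform_bounds(1)[OF AB n(1) p] in \<open>auto simp: V M_def\<close>)
qed

lemma lambda_ratio_two_two_graph:
  fixes p :: real and A B :: "'a set"
  assumes "disjoint_pair n A B" "n \<ge> 2" "even n" "p \<ge> 2"
  shows "lambda_max p (two_two_graph A B) / \<bar>lambda_min p (two_two_graph A B)\<bar> = real n - 1"
proof -
  define M where "M = (real n * (real (2 * n) powr (- 1 / p))\<^sup>2)\<^sup>2"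
  have pos: "real n - 1 > 0" "M > 0" using assms by (auto simp: M_def)
  have "6 * m\<^sup>2 * M / \<bar>- (6 * m * M)\<bar> = m" if "m > 0" for m :: real
    using that pos by (simp add: abs_mult power2_eq_square)
  from this[OF pos(1)] show ?thesis
    using lambda_two_two_graph[OF assms] by (simp add: M_def)
qed

section \<open>Chromatic number\<close>

lemma four_graph_two_two_graph:
  assumes "disjoint_pair n A B"
  shows "four_graph (two_two_graph A B)"
  using assms by (auto simp: four_graph_def two_two_graph_def disjoint_pair_def)

lemma edges_two_two_graph_nonempty:
  assumes "disjoint_pair n A B" "n \<ge> 2"
  shows "edges (two_two_graph A B) \<noteq> {}"
proof -
  have fin: "finite A" "finite B" "A \<inter> B = {}" and card: "card A = n" "card B = n"
    using assms by (auto simp: disjoint_pair_def)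
  obtain d where d: "d \<subseteq> A" "card d = 2"
    using obtain_subset_with_card_n[of 2 A] card assms by auto
  obtain e where e: "e \<subseteq> B" "card e = 2"
    using obtain_subset_with_card_n[of 2 B] card assms by auto
  have "card (d \<union> e) = card d + card e"
    by (rule card_Un_disjoint) (use d e fin finite_subset in auto)
  moreover have "(d \<union> e) \<inter> A = d" using d e fin by auto
  ultimately have "d \<union> e \<in> edges (two_two_graph A B)"
    using d e by (auto simp: two_two_graph_def)
  then show ?thesis by blast
qed

lemma k_chromatic_2_two_two_graph:
  assumes "disjoint_pair n A B" "n > 0"
  shows "k_chromatic 2 (two_two_graph A B)"
proof -
  have fin: "finite A" "finite B" "A \<inter> B = {}" and ne: "A \<noteq> {}" "B \<noteq> {}"
    using assms by (auto simp: disjoint_pair_def)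
  have "partition_on (A \<union> B) {A, B}"
    using fin ne by (auto simp: partition_on_def disjoint_def)
  moreover have "A \<noteq> B" using fin ne by auto
  then have "card {A, B} = 2" by simp
  moreover have "\<not> e \<subseteq> A" "\<not> e \<subseteq> B" if "e \<in> edges (two_two_graph A B)" for e
  proof -
    have e: "card e = 4" "card (e \<inter> A) = 2" using that by (auto simp: two_two_graph_def)
    show "\<not> e \<subseteq> A" using e by (auto simp: Int_absorb2)
    show "\<not> e \<subseteq> B"
    proof
      assume "e \<subseteq> B"
      then have "e \<inter> A = {}" using fin by auto
      then show False using e by simp
    qed
  qed
  moreover have "verts (two_two_graph A B) = A \<union> B" by (simp add: two_two_graph_def)
  ultimately show ?thesis unfolding k_chromatic_def by auto
qed

lemma k_chromatic_ge_2:
  assumes "four_graph G" "edges G \<noteq> {}" "k_chromatic k G"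
  shows "k \<ge> 2"
proof (rule ccontr)
  assume "\<not> k \<ge> 2"
  obtain P where P: "partition_on (verts G) P" "card P = k" "\<forall>S\<in>P. \<forall>e\<in>edges G. \<not> e \<subseteq> S"
    using assms by (auto simp: k_chromatic_def)
  obtain e where e: "e \<in> edges G" "e \<subseteq> verts G" "card e = 4"
    using assms by (auto simp: four_graph_def)
  have finP: "finite P"
    using P assms finite_elements four_graph_def by metis
  obtain i where "i \<in> e" using e by fastforce
  then have "P \<noteq> {}" using P e by (auto simp: partition_on_def)
  then have "card P = 1" using \<open>\<not> k \<ge> 2\<close> P finP by (cases "card P") auto
  then obtain S where "P = {S}" by (auto simp: card_1_singleton_iff)
  then have "S = verts G" using P by (auto simp: partition_on_def)
  then show False using P e \<open>P = {S}\<close> by auto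
qed

lemma chromatic_number_two_two_graph:
  assumes "disjoint_pair n A B" "n \<ge> 2"
  shows "chromatic_number (two_two_graph A B) = 2"
  unfolding chromatic_number_def
proof (rule Least_equality)
  show "k_chromatic 2 (two_two_graph A B)"
    using k_chromatic_2_two_two_graph[of n A B] assms by simp
qed (use k_chromatic_ge_2 four_graph_two_two_graph edges_two_two_graph_nonempty assms in blast)

section \<open>The ratio is unbounded at chromatic number two\<close>

theorem mainTheorem2:
  shows "(\<forall>n (A :: 'a set) B. 0 < n \<and> even n \<and> disjoint_pair n A B \<longrightarrow>
            four_graph (two_two_graph A B) \<and>
            k_chromatic 2 (two_two_graph A B) \<and>
            chromatic_number (two_two_graph A B) = 2) \<and>
         (\<forall>p :: real. p \<ge> 2 \<longrightarrow>
            (\<exists>c > 0. \<forall>\<^sub>F n in sequentially. even n \<longrightarrow>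
               (\<forall>(A :: 'a set) B. disjoint_pair n A B \<longrightarrow>
                  lambda_max p (two_two_graph A B) / \<bar>lambda_min p (two_two_graph A B)\<bar>
                    \<ge> c * real n))) \<and>
         (\<forall>p :: real. p \<ge> 2 \<longrightarrow>
            \<not> (\<exists>f :: nat \<Rightarrow> real \<Rightarrow> real. \<forall>G :: nat hypergraph.
                  four_graph G \<and> edges G \<noteq> {} \<longrightarrow>
                  lambda_max p G / \<bar>lambda_min p G\<bar> \<le> f (chromatic_number G) p))"
proof (intro conjI allI impI)
  fix n and A B :: "'a set"
  assume *: "0 < n \<and> even n \<and> disjoint_pair n A B"
  then have "n \<ge> 2" by (auto elim: evenE)
  then show "four_graph (two_two_graph A B)" "k_chromatic 2 (two_two_graph A B)"
    "chromatic_number (two_two_graph A B) = 2"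
    using * four_graph_two_two_graph[of n A B] k_chromatic_2_two_two_graph[of n A B]
      chromatic_number_two_two_graph[of n A B]
    by blast+
next
  fix p :: real assume p: "p \<ge> 2"
  show "\<exists>c > 0. \<forall>\<^sub>F n in sequentially. even n \<longrightarrow>
      (\<forall>(A :: 'a set) B. disjoint_pair n A B \<longrightarrow>
        lambda_max p (two_two_graph A B) / \<bar>lambda_min p (two_two_graph A B)\<bar> \<ge> c * real n)"
  proof (intro exI[of _ "1 / 2"] conjI eventually_sequentiallyI[of 2] impI allI)
    fix n and A B :: "'a set"
    assume "2 \<le> n" "even n" "disjoint_pair n A B"
    then show "1 / 2 * real n
        \<le> lambda_max p (two_two_graph A B) / \<bar>lambda_min p (two_two_graph A B)\<bar>"
      using lambda_ratio_two_two_graph[of n A B p] p by simp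
  qed simp
next
  fix p :: real assume p: "p \<ge> 2"
  show "\<not> (\<exists>f :: nat \<Rightarrow> real \<Rightarrow> real. \<forall>G :: nat hypergraph.
      four_graph G \<and> edges G \<noteq> {} \<longrightarrow>
      lambda_max p G / \<bar>lambda_min p G\<bar> \<le> f (chromatic_number G) p)"
  proof
    assume "\<exists>f :: nat \<Rightarrow> real \<Rightarrow> real. \<forall>G :: nat hypergraph.
      four_graph G \<and> edges G \<noteq> {} \<longrightarrow>
      lambda_max p G / \<bar>lambda_min p G\<bar> \<le> f (chromatic_number G) p"
    then obtain f :: "nat \<Rightarrow> real \<Rightarrow> real" where f: "\<And>G :: nat hypergraph.
      four_graph G \<Longrightarrow> edges G \<noteq> {} \<Longrightarrow>
      lambda_max p G / \<bar>lambda_min p G\<bar> \<le> f (chromatic_number G) p" by blast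
    obtain k :: nat where k: "f 2 p < real k" using reals_Archimedean2 by blast
    define n where "n = 2 * (k + 1)"
    have n: "n \<ge> 2" "even n" by (auto simp: n_def)
    have AB: "disjoint_pair n {..<n} {n..<2 * n}" by (auto simp: disjoint_pair_def)
    have "real n - 1 \<le> f 2 p"
      using f[OF four_graph_two_two_graph[OF AB] edges_two_two_graph_nonempty[OF AB n(1)]]
        lambda_ratio_two_two_graph[OF AB n p] chromatic_number_two_two_graph[OF AB n(1)] by simp
    then show False using k by (simp add: n_def)
  qed
qed

end
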